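(* Let $\xi$ be an $\mathbb{N}_0$-valued random variable with $p_k=\mathbb{P}(\xi=k)$, $p_0>0$ and probability generating function $g(x)=\sum_{k\ge0}p_kx^k$. Consider the Maker-Breaker game on the Galton-Watson tree with offspring distribution $\xi$ when the nodes carry no further information, and let $p$ (resp. $\bar p$) be the probability that Breaker wins when Breaker (resp. Maker) starts. If $p<1$, then $\bar p>g(p)$.
   Context: The Galton-Watson tree is the random rooted family tree with root $\mathbf{0}$ in which all individuals have independent numbers of children distributed as $\xi$. In the $(1,1)$ Maker-Breaker game the players move alternately; in each turn a player picks one available edge: Maker fixates it (securing it from deletion), Breaker removes it. Breaker wins if at some time the root lies in a finite component separated from the rest by removed edges; otherwise Maker wins. Internal nodes are those connected to the root by fixated edges (including the root); external nodes are children of internal nodes that are neither internal nor cut off. No-information regime ($I(v)=\emptyset$): the tree is explored during the game, and the players see only the internal and external nodes. In each turn a player plays an edge between an internal and an external node; all such edges are indistinguishable, so the choice is arbitrary. The number of available edges at Maker's successive turns is described by the embedded random walk $S_n=S_{n-1}+(\xi_n-2)$, $n\ge 1$, with $(\xi_n)_{n\ge1}$ i.i.d. copies of $\xi$ and $S_0=1$ if Breaker starts, $S_0=2$ if Maker starts. Maker wins iff $S_n>0$ for all $n\ge1$; that is, $p=\mathbb{P}(S_n\le 0\text{ for some }n\ge1\mid S_0=1)$ and $\bar p=\mathbb{P}(S_n\le 0\text{ for some }n\ge1\mid S_0=2)$. *)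

theory Defs
  imports "HOL-Probability.Probability"
begin

text \<open>
  Individuals are words over the natural numbers (Ulam-Harris labels): the root is \<open>[]\<close> and
  the children of \<open>v\<close> are \<open>v @ [i]\<close> for \<open>i < T v\<close>, where \<open>T\<close> gives the
  numbers of children.  Numbers attached to words that are not individuals of the tree are
  irrelevant.  An edge is named by its endpoint farther from the root.
\<close>

type_synonym node = "nat list"
type_synonym family_tree = "node \<Rightarrow> nat"

datatype player = Maker | Breaker

type_synonym history = "(player \<times> node) list"  \<comment> \<open>edges played so far, latest first\<close>

text \<open>
  Only edges between an internal and an external node are ever played, so every fixated edge is
  joined to the root by fixated edges; hence the internal nodes are the root and the endpoints
  of the fixated edges.
\<close>

definition internal :: "history \<Rightarrow> node set" where
  "internal h = insert [] {v. (Maker, v) \<in> set h}"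

definition removed :: "history \<Rightarrow> node set" where
  "removed h = {v. (Breaker, v) \<in> set h}"

definition external :: "family_tree \<Rightarrow> history \<Rightarrow> node set" where
  "external T h = {v @ [i] | v i. v \<in> internal h \<and> i < T v} - internal h - removed h"

inductive_set root_component :: "family_tree \<Rightarrow> history \<Rightarrow> node set"
  for T :: family_tree and h :: history where
  root: "[] \<in> root_component T h"
| child: "v \<in> root_component T h \<Longrightarrow> i < T v \<Longrightarrow> v @ [i] \<notin> removed h
    \<Longrightarrow> v @ [i] \<in> root_component T h"

text \<open>
  The players see the internal and the external nodes, that is, the numbers of children of the
  internal nodes, and nothing else of the tree.  A choice rule selects the edge to be played,
  as a function of the player to move, the earlier moves and this information.
\<close>

definition visible :: "family_tree \<Rightarrow> history \<Rightarrow> (node \<rightharpoonup> nat)" where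
  "visible T h = (\<lambda>v. Some (T v)) |` internal h"

type_synonym choice_rule = "player \<Rightarrow> history \<Rightarrow> (node \<rightharpoonup> nat) \<Rightarrow> node"

definition admissible :: "choice_rule \<Rightarrow> bool" where
  "admissible \<sigma> \<longleftrightarrow>
    (\<forall>c T h. external T h \<noteq> {} \<longrightarrow> \<sigma> c h (visible T h) \<in> external T h)"

fun opponent :: "player \<Rightarrow> player" where
  "opponent Maker = Breaker"
| "opponent Breaker = Maker"

definition turn :: "player \<Rightarrow> nat \<Rightarrow> player" where
  "turn a n = (if even n then a else opponent a)"

text \<open>
  The history after \<open>n\<close> turns when \<open>a\<close> starts; it stops changing once there is no edge left to
  play.
\<close>

primrec play :: "player \<Rightarrow> choice_rule \<Rightarrow> family_tree \<Rightarrow> nat \<Rightarrow> history" where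
  "play a \<sigma> T 0 = []"
| "play a \<sigma> T (Suc n) =
    (let h = play a \<sigma> T n; c = turn a n
     in if external T h = {} then h else (c, \<sigma> c h (visible T h)) # h)"

text \<open>
  No removed edge is required: a finite tree counts as won by Breaker.  There the players run out
  of edges, which is Breaker's win in terms of the number of available edges as well.
\<close>

definition breaker_wins :: "player \<Rightarrow> choice_rule \<Rightarrow> family_tree \<Rightarrow> bool" where
  "breaker_wins a \<sigma> T \<longleftrightarrow> (\<exists>n. finite (root_component T (play a \<sigma> T n)))"

definition breaker_win_prob ::
    "'a measure \<Rightarrow> ('a \<Rightarrow> family_tree) \<Rightarrow> player \<Rightarrow> choice_rule \<Rightarrow> real" where
  "breaker_win_prob M T a \<sigma> = measure M {\<omega> \<in> space M. breaker_wins a \<sigma> (T \<omega>)}"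

definition galton_watson :: "'a measure \<Rightarrow> ('a \<Rightarrow> nat) \<Rightarrow> ('a \<Rightarrow> family_tree) \<Rightarrow> bool" where
  "galton_watson M \<xi> T \<longleftrightarrow>
    prob_space.indep_vars M (\<lambda>_. count_space UNIV) (\<lambda>v \<omega>. T \<omega> v) UNIV \<and>
    (\<forall>v. distr M (count_space UNIV) (\<lambda>\<omega>. T \<omega> v) = distr M (count_space UNIV) \<xi>)"

definition pgf :: "'a measure \<Rightarrow> ('a \<Rightarrow> nat) \<Rightarrow> real \<Rightarrow> real" where
  "pgf M \<xi> x = (\<Sum>k. measure M {\<omega> \<in> space M. \<xi> \<omega> = k} * x ^ k)"

text \<open>The visible information determines the external nodes, so admissible rules exist.\<close>

lemma external_visible:
  "external T h = {v @ [i] | v i n. visible T h v = Some n \<and> i < n} - internal h - removed h"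
  by (auto simp: external_def visible_def restrict_map_def split: if_splits)

lemma admissible_exists: "\<exists>\<sigma>. admissible \<sigma>"
proof -
  define E where "E h m = {v @ [i] | v i n. m v = Some n \<and> i < n} - internal h - removed h"
    for h :: history and m :: "node \<rightharpoonup> nat"
  have "external T h = E h (visible T h)" for T h
    unfolding E_def by (rule external_visible)
  then have "admissible (\<lambda>c h m. SOME v. v \<in> E h m)"
    unfolding admissible_def by (metis some_in_eq)
  then show ?thesis by blast
qed

end

theory Submission
  imports Defs
begin

text \<open>
  Whichever edge is chosen, a turn of Breaker lowers the number of available edges by one, and a
  turn of Maker changes it by the fresh offspring number minus one.  So the probability that
  the edges run out depends only on the player to move and on the number of available edges.
  Let \<open>q k\<close> be this probability when Maker is to move and \<open>k\<close> edges are available.  Conditioning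
  on the first revealed offspring number gives
  \<open>p = q 1 = (\<Sum>j. p\<^sub>j * q (j - 1))\<close> and \<open>pbar = q 2 = (\<Sum>j. p\<^sub>j * q j)\<close>, where
  \<open>0 - 1\<close> is truncated to \<open>0\<close> and \<open>q 0 = 1\<close>.
  To exhaust \<open>k + l\<close> edges the walk may first lose \<open>k\<close> of them and then the remaining ones, so
  \<open>q k * q l \<le> q (k + l)\<close>; hence \<open>p ^ k \<le> q k\<close>.  The inequality is strict for
  \<open>k = 2\<close>, because the walk drops by two at once with probability \<open>p\<^sub>0 > 0\<close>, hence for all
  \<open>k \<ge> 2\<close>; and \<open>p < 1\<close> forces \<open>p\<^sub>k > 0\<close> for some \<open>k \<ge> 2\<close>.
\<close>

section \<open>Histories\<close>

text \<open>The invariant of actual play. It ensures that no child of an external node occurs in the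
  history, so that Maker's move at \<open>v\<close> opens exactly \<open>T v\<close> fresh
  edges.\<close>

definition valid_history :: "family_tree \<Rightarrow> history \<Rightarrow> bool" where
  "valid_history T h \<longleftrightarrow>
    (\<forall>w i. w @ [i] \<in> internal h \<longrightarrow> w \<in> internal h \<and> i < T w \<and> w @ [i] \<notin> removed h) \<and>
    (\<forall>w i. w @ [i] \<in> removed h \<longrightarrow> w \<in> internal h)"

lemma internal_Nil [simp]: "internal [] = {[]}"
  and internal_Maker [simp]: "internal ((Maker, v) # h) = insert v (internal h)"
  and internal_Breaker [simp]: "internal ((Breaker, v) # h) = internal h"
  by (auto simp: internal_def)

lemma removed_Nil [simp]: "removed [] = {}"
  and removed_Maker [simp]: "removed ((Maker, v) # h) = removed h"
  and removed_Breaker [simp]: "removed ((Breaker, v) # h) = insert v (removed h)"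
  by (auto simp: removed_def)

lemma Nil_in_internal [simp]: "[] \<in> internal h"
  by (simp add: internal_def)

lemma finite_internal [simp]: "finite (internal h)"
proof -
  have "internal h \<subseteq> insert [] (snd ` set h)"
    by (force simp: internal_def)
  then show ?thesis by (rule finite_subset) simp
qed

lemma external_eq_UN:
  "external T h = (\<Union>v\<in>internal h. (\<lambda>i. v @ [i]) ` {..<T v}) - internal h - removed h"
  by (auto simp: external_def)

lemma finite_external [simp]: "finite (external T h)"
  by (simp add: external_eq_UN)

lemma valid_history_Nil: "valid_history T []"
  by (simp add: valid_history_def)

lemma valid_history_Cons:
  assumes "valid_history T h" and "v \<in> external T h"
  shows "valid_history T ((c, v) # h)"
  using assms by (cases c) (auto simp: valid_history_def external_def)

lemma external_Breaker: "external T ((Breaker, v) # h) = external T h - {v}"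
  by (auto simp: external_def)

lemma external_Maker:
  assumes "valid_history T h" and "v \<in> external T h"
  shows "external T ((Maker, v) # h) = (external T h - {v}) \<union> (\<lambda>i. v @ [i]) ` {..<T v}"
proof -
  have "v @ [i] \<notin> internal h" "v @ [i] \<notin> removed h" for i
    using assms by (auto simp: external_def valid_history_def)
  then show ?thesis by (auto simp: external_eq_UN)
qed

lemma card_external_Breaker:
  "v \<in> external T h \<Longrightarrow> card (external T ((Breaker, v) # h)) = card (external T h) - 1"
  by (simp add: external_Breaker)

lemma card_external_Maker:
  assumes "valid_history T h" and "v \<in> external T h"
  shows "card (external T ((Maker, v) # h)) = card (external T h) - 1 + T v"
proof -
  have "(external T h - {v}) \<inter> (\<lambda>i. v @ [i]) ` {..<T v} = {}"
    using assms by (auto simp: external_def)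
  moreover have "inj_on (\<lambda>i. v @ [i]) {..<T v}"
    by (auto simp: inj_on_def)
  ultimately show ?thesis
    using assms by (simp add: external_Maker card_Un_disjoint card_image)
qed

text \<open>A position depends on the tree only through the numbers already revealed. This and the
  next two facts let one tree replace another that agrees with it on the internal nodes.\<close>

lemma external_cong:
  "(\<And>u. u \<in> internal h \<Longrightarrow> S u = T u) \<Longrightarrow> external S h = external T h"
  by (auto simp: external_def)

lemma visible_cong:
  "(\<And>u. u \<in> internal h \<Longrightarrow> S u = T u) \<Longrightarrow> visible S h = visible T h"
  by (auto simp: visible_def restrict_map_def)

lemma valid_history_cong:
  assumes "\<And>u. u \<in> internal h \<Longrightarrow> S u = T u"
  shows "valid_history S h = valid_history T h"
proof -
  have "(w \<in> internal h \<and> i < S w \<and> b) = (w \<in> internal h \<and> i < T w \<and> b)" for w i b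
    using assms[of w] by auto
  then show ?thesis by (simp add: valid_history_def)
qed

lemma admissibleD:
  "admissible \<sigma> \<Longrightarrow> external T h \<noteq> {} \<Longrightarrow> \<sigma> c h (visible T h) \<in> external T h"
  by (simp add: admissible_def)

section \<open>Winning by exhaustion\<close>

lemma internal_subset_root_component:
  assumes "valid_history T h" and "v \<in> internal h"
  shows "v \<in> root_component T h"
  using assms(2)
proof (induction v rule: rev_induct)
  case Nil
  show ?case by (rule root_component.root)
next
  case (snoc i w)
  then show ?case
    using assms(1) by (auto simp: valid_history_def intro: root_component.child)
qed

lemma external_subset_root_component:
  assumes "valid_history T h"
  shows "external T h \<subseteq> root_component T h - internal h"
  using internal_subset_root_component[OF assms]
  by (auto simp: external_def intro: root_component.child)

lemma root_component_subset_internal: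
  assumes "external T h = {}"
  shows "root_component T h \<subseteq> internal h"
proof
  fix v assume "v \<in> root_component T h"
  then show "v \<in> internal h"
  proof induction
    case root
    show ?case by simp
  next
    case (child v i)
    then show ?case using assms by (auto simp: external_def)
  qed
qed

lemma root_component_mono:
  assumes "removed h \<subseteq> removed h'"
  shows "root_component T h' \<subseteq> root_component T h"
proof
  fix v assume "v \<in> root_component T h'"
  then show "v \<in> root_component T h"
    by induction (use assms in \<open>auto intro: root_component.intros\<close>)
qed

lemma removed_not_in_root_component:
  assumes "v \<in> removed h" and "v \<noteq> []"
  shows "v \<notin> root_component T h"
proof
  assume "v \<in> root_component T h"
  then show False by cases (use assms in auto)
qed

text \<open>A termination measure: no move enlarges the unreached part, and \<open>v\<close> leaves
  it, because Maker makes \<open>v\<close> internal and Breaker cuts it off.\<close>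

lemma unreached_part_shrinks:
  assumes "valid_history T h" and v: "v \<in> external T h"
  shows "root_component T ((c, v) # h) - internal ((c, v) # h)
    \<subset> root_component T h - internal h"
proof -
  have "root_component T ((c, v) # h) \<subseteq> root_component T h"
    by (rule root_component_mono) (cases c, auto)
  moreover have "internal h \<subseteq> internal ((c, v) # h)"
    by (cases c) auto
  moreover have "v \<in> root_component T h - internal h"
    using external_subset_root_component[OF assms(1)] v by blast
  moreover have "v \<notin> root_component T ((c, v) # h) - internal ((c, v) # h)"
  proof (cases c)
    case Breaker
    have "v \<noteq> []" using v by (auto simp: external_def)
    then show ?thesis using removed_not_in_root_component Breaker by auto
  qed simp
  ultimately show ?thesis by blast
qed

lemma valid_history_play:
  "admissible \<sigma> \<Longrightarrow> valid_history T (play a \<sigma> T n)"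
  by (induction n) (auto simp: Let_def valid_history_Nil intro!: valid_history_Cons admissibleD)

text \<open>Once the component is finite, every further turn uses up one of its unreached nodes; the
  induction is on their number.\<close>

lemma finite_root_component_exhausts:
  assumes adm: "admissible \<sigma>" and "finite (root_component T (play a \<sigma> T n))"
  shows "\<exists>m. external T (play a \<sigma> T m) = {}"
  using assms(2)
proof (induction "card (root_component T (play a \<sigma> T n) - internal (play a \<sigma> T n))"
    arbitrary: n rule: less_induct)
  case less
  let ?h = "play a \<sigma> T n"
  show ?case
  proof (cases "external T ?h = {}")
    case False
    define v where "v = \<sigma> (turn a n) ?h (visible T ?h)"
    have v: "v \<in> external T ?h"
      unfolding v_def by (rule admissibleD[OF adm False])
    have step: "play a \<sigma> T (Suc n) = (turn a n, v) # ?h"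
      using False by (simp add: v_def Let_def)
    have "root_component T (play a \<sigma> T (Suc n)) \<subseteq> root_component T ?h"
      unfolding step by (rule root_component_mono) (cases "turn a n", auto)
    then have "finite (root_component T (play a \<sigma> T (Suc n)))"
      using less.prems finite_subset by blast
    moreover have "card (root_component T (play a \<sigma> T (Suc n)) - internal (play a \<sigma> T (Suc n)))
        < card (root_component T ?h - internal ?h)"
      unfolding step using less.prems
      by (intro psubset_card_mono unreached_part_shrinks valid_history_play adm v) auto
    ultimately show ?thesis by (intro less.hyps)
  qed blast
qed

lemma breaker_wins_iff_external_empty:
  assumes "admissible \<sigma>"
  shows "breaker_wins a \<sigma> T \<longleftrightarrow> (\<exists>n. external T (play a \<sigma> T n) = {})"
  unfolding breaker_wins_def
  by (meson assms finite_root_component_exhausts root_component_subset_internal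
    finite_subset finite_internal)

text \<open>Unfolds from the first turn at an arbitrary position, whereas \<open>play\<close> adds
  the last turn. This form allows conditioning on the first revealed number.\<close>

primrec exhausted :: "choice_rule \<Rightarrow> family_tree \<Rightarrow> nat \<Rightarrow> player \<Rightarrow> history \<Rightarrow> bool" where
  "exhausted \<sigma> T 0 c h \<longleftrightarrow> external T h = {}"
| "exhausted \<sigma> T (Suc n) c h \<longleftrightarrow> external T h = {} \<or>
    exhausted \<sigma> T n (opponent c) ((c, \<sigma> c h (visible T h)) # h)"

lemma turn_0 [simp]: "turn a 0 = a"
  by (simp add: turn_def)

lemma turn_Suc: "turn a (Suc n) = opponent (turn a n)"
  by (cases a) (auto simp: turn_def)

lemma play_stops:
  assumes "external T (play a \<sigma> T m) = {}"
  shows "play a \<sigma> T (m + n) = play a \<sigma> T m"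
  using assms by (induction n) auto

lemma exhausted_play:
  "exhausted \<sigma> T n (turn a m) (play a \<sigma> T m) \<longleftrightarrow> external T (play a \<sigma> T (m + n)) = {}"
proof (induction n arbitrary: m)
  case (Suc n)
  show ?case
  proof (cases "external T (play a \<sigma> T m) = {}")
    case True
    then show ?thesis using play_stops[OF True, of "Suc n"] by simp
  next
    case False
    then show ?thesis using Suc.IH[of "Suc m"] by (simp add: turn_Suc Let_def)
  qed
qed simp

lemma breaker_wins_iff_exhausted:
  assumes "admissible \<sigma>"
  shows "breaker_wins a \<sigma> T \<longleftrightarrow> (\<exists>n. exhausted \<sigma> T n a [])"
  using exhausted_play[of \<sigma> T _ a 0] by (simp add: breaker_wins_iff_external_empty[OF assms])

lemma exhausted_Suc: "exhausted \<sigma> T n c h \<Longrightarrow> exhausted \<sigma> T (Suc n) c h"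
proof (induction n arbitrary: c h)
  case (Suc n)
  show ?case
  proof (cases "external T h = {}")
    case False
    with Suc.prems have "exhausted \<sigma> T n (opponent c) ((c, \<sigma> c h (visible T h)) # h)" by simp
    from Suc.IH[OF this] show ?thesis by (simp only: exhausted.simps(2)) blast
  qed simp
qed simp

section \<open>The walk of the number of available edges\<close>

text \<open>Probability that the walk has run out within \<open>n\<close> turns. Values in
  \<open>ennreal\<close> spare all summability conditions; state 0 is absorbing, so
  \<open>k - 1\<close> is never truncated.\<close>

primrec exhaust_prob :: "(nat \<Rightarrow> ennreal) \<Rightarrow> nat \<Rightarrow> player \<Rightarrow> nat \<Rightarrow> ennreal" where
  "exhaust_prob w 0 c k = (if k = 0 then 1 else 0)"
| "exhaust_prob w (Suc n) c k = (if k = 0 then 1 else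
    (case c of Breaker \<Rightarrow> exhaust_prob w n Maker (k - 1)
     | Maker \<Rightarrow> (\<Sum>j. w j * exhaust_prob w n Breaker (k - 1 + j))))"

definition ruin_prob :: "(nat \<Rightarrow> ennreal) \<Rightarrow> player \<Rightarrow> nat \<Rightarrow> ennreal" where
  "ruin_prob w c k = (SUP n. exhaust_prob w n c k)"

lemma exhaust_prob_0 [simp]: "exhaust_prob w n c 0 = 1"
  by (cases n) auto

lemma exhaust_prob_le_Suc: "exhaust_prob w n c k \<le> exhaust_prob w (Suc n) c k"
proof (induction n arbitrary: c k)
  case (Suc n)
  show ?case
  proof (cases "k = 0")
    case False
    show ?thesis
    proof (cases c)
      case Maker
      have "(\<Sum>j. w j * exhaust_prob w n Breaker (k - 1 + j))
          \<le> (\<Sum>j. w j * exhaust_prob w (Suc n) Breaker (k - 1 + j))"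
        by (intro suminf_le mult_left_mono Suc.IH) auto
      then show ?thesis
        using False Maker by (simp only: exhaust_prob.simps(2) if_False player.simps)
    next
      case Breaker
      then show ?thesis
        using False Suc.IH[of Maker "k - 1"]
        by (simp only: exhaust_prob.simps(2) if_False player.simps)
    qed
  qed simp
qed simp

lemma incseq_exhaust_prob: "incseq (\<lambda>n. exhaust_prob w n c k)"
  by (intro incseq_SucI exhaust_prob_le_Suc)

lemma ruin_prob_0 [simp]: "ruin_prob w c 0 = 1"
  by (simp add: ruin_prob_def)

lemma ruin_prob_eq_SUP_Suc: "ruin_prob w c k = (SUP n. exhaust_prob w (Suc n) c k)"
proof (rule antisym)
  show "ruin_prob w c k \<le> (SUP n. exhaust_prob w (Suc n) c k)"
    unfolding ruin_prob_def by (intro SUP_mono) (metis exhaust_prob_le_Suc)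
  show "(SUP n. exhaust_prob w (Suc n) c k) \<le> ruin_prob w c k"
    unfolding ruin_prob_def by (intro SUP_mono) blast
qed

lemma ruin_prob_Breaker_Suc: "ruin_prob w Breaker (Suc k) = ruin_prob w Maker k"
  by (simp add: ruin_prob_eq_SUP_Suc[of w Breaker]) (simp add: ruin_prob_def)

text \<open>Monotone convergence: the values increase with \<open>n\<close>, so the limit passes
  through the series.\<close>

lemma suminf_mult_ruin_prob:
  "(\<Sum>j. w j * ruin_prob v c (f j)) = (SUP n. \<Sum>j. w j * exhaust_prob v n c (f j))"
proof -
  have "(\<Sum>j. w j * ruin_prob v c (f j)) = (\<Sum>j. SUP n. w j * exhaust_prob v n c (f j))"
    by (simp add: ruin_prob_def SUP_mult_left_ennreal)
  also have "\<dots> = (SUP n. \<Sum>j. w j * exhaust_prob v n c (f j))"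
    by (rule ennreal_suminf_SUP_eq)
      (auto intro!: incseq_SucI mult_left_mono exhaust_prob_le_Suc simp del: exhaust_prob.simps)
  finally show ?thesis .
qed

lemma ruin_prob_Maker_Suc:
  "ruin_prob w Maker (Suc k) = (\<Sum>j. w j * ruin_prob w Breaker (k + j))"
  by (simp add: ruin_prob_eq_SUP_Suc[of w Maker] suminf_mult_ruin_prob)

section \<open>Bounds, monotonicity and supermultiplicativity of ruin probabilities\<close>

context
  fixes w :: "nat \<Rightarrow> ennreal"
  assumes suminf_le_1: "(\<Sum>j. w j) \<le> 1"
begin

lemma exhaust_prob_le_1: "exhaust_prob w n c k \<le> 1"
proof (induction n arbitrary: c k)
  case (Suc n)
  have "(\<Sum>j. w j * exhaust_prob w n Breaker (k - 1 + j)) \<le> (\<Sum>j. w j)"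
  proof (intro suminf_le)
    fix j show "w j * exhaust_prob w n Breaker (k - 1 + j) \<le> w j"
      using mult_left_mono[OF Suc.IH, of "w j"] by simp
  qed auto
  also note suminf_le_1
  finally show ?case using Suc.IH by (auto split: player.split)
qed simp

lemma ruin_prob_le_1: "ruin_prob w c k \<le> 1"
  unfolding ruin_prob_def by (intro SUP_least exhaust_prob_le_1)

lemma exhaust_prob_Suc_le: "exhaust_prob w n c (Suc k) \<le> exhaust_prob w n c k"
proof (induction n arbitrary: c k)
  case (Suc n)
  show ?case
  proof (cases k)
    case 0
    then show ?thesis
      using exhaust_prob_le_1[of "Suc n"] by (simp del: exhaust_prob.simps)
  next
    case (Suc k')
    then show ?thesis
      using Suc.IH by (auto split: player.split intro!: suminf_le mult_left_mono)
  qed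
qed simp

text \<open>Breaker's move leads to Maker's position with one edge less, which is exhausted more
  easily. Needed below, where either player may be to move once the first \<open>k\<close> edges are
  gone.\<close>

lemma ruin_prob_Maker_le_Breaker: "ruin_prob w Maker k \<le> ruin_prob w Breaker k"
proof (cases k)
  case (Suc k')
  have "ruin_prob w Maker (Suc k') \<le> ruin_prob w Maker k'"
    unfolding ruin_prob_def by (intro SUP_mono) (metis UNIV_I exhaust_prob_Suc_le)
  then show ?thesis by (simp add: Suc ruin_prob_Breaker_Suc)
qed simp

text \<open>Set \<open>l\<close> edges aside and exhaust the other \<open>k\<close> within
  \<open>n\<close> turns. Whoever is to move then, Maker to move is the case less favourable to
  exhaustion, whence the factor \<open>ruin_prob w Maker l\<close>. The turn bound \<open>n\<close>
  carries the induction; the supremum is taken afterwards.\<close>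

lemma exhaust_prob_mult_le:
  "exhaust_prob w n c k * ruin_prob w Maker l \<le> ruin_prob w c (k + l)"
proof (induction n arbitrary: c k)
  case 0
  show ?case
    using ruin_prob_Maker_le_Breaker[of l] by (cases c) auto
next
  case (Suc n)
  show ?case
  proof (cases k)
    case 0
    then show ?thesis
      using ruin_prob_Maker_le_Breaker[of l] by (cases c) auto
  next
    case (Suc k')
    show ?thesis
    proof (cases c)
      case Maker
      have "exhaust_prob w (Suc n) c k * ruin_prob w Maker l =
          (\<Sum>j. w j * exhaust_prob w n Breaker (k' + j) * ruin_prob w Maker l)"
        by (simp add: Maker Suc)
      also have "\<dots> \<le> (\<Sum>j. w j * ruin_prob w Breaker (k' + l + j))"
      proof (intro suminf_le)
        fix j
        show "w j * exhaust_prob w n Breaker (k' + j) * ruin_prob w Maker l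
            \<le> w j * ruin_prob w Breaker (k' + l + j)"
          using mult_left_mono[OF Suc.IH[of Breaker "k' + j"], of "w j"]
          by (simp add: mult.assoc add.assoc add.commute[of j l])
      qed auto
      finally show ?thesis by (simp add: Maker Suc ruin_prob_Maker_Suc)
    next
      case Breaker
      then show ?thesis
        using Suc.IH[of Maker k'] by (simp add: Suc ruin_prob_Breaker_Suc)
    qed
  qed
qed

lemma ruin_prob_mult_le:
  "ruin_prob w Maker k * ruin_prob w Maker l \<le> ruin_prob w Maker (k + l)"
  unfolding ruin_prob_def[of w Maker k] SUP_mult_right_ennreal
  by (intro SUP_least exhaust_prob_mult_le)

end

section \<open>The inequality for supermultiplicative sequences\<close>

lemma suminf_power_less_suminf:
  fixes w r :: "nat \<Rightarrow> real"
  assumes w: "\<And>j. 0 \<le> w j" "w sums 1" "0 < w 0"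
    and r: "\<And>k. 0 \<le> r k" "\<And>k. r k \<le> 1" "r 0 = 1"
    and mult: "\<And>k l. r k * r l \<le> r (k + l)"
    and r1: "r 1 = (\<Sum>j. w j * r (j - 1))" and r2: "r 2 = (\<Sum>j. w j * r j)"
    and less: "r 1 < 1"
  shows "(\<Sum>j. w j * r 1 ^ j) < (\<Sum>j. w j * r j)"
proof -
  have sw: "summable w" using w(2) by (rule sums_summable)
  have summ: "summable (\<lambda>j. w j * f j)" if "\<And>j. 0 \<le> f j" "\<And>j. f j \<le> 1" for f :: "nat \<Rightarrow> real"
  proof (rule summable_comparison_test'[OF sw])
    fix j show "norm (w j * f j) \<le> w j"
      using mult_left_mono[OF that(2), of "w j"] that(1) w(1) by (simp add: abs_mult)
  qed
  have strict: "(\<Sum>j. w j * f j) < (\<Sum>j. w j * g j)"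
    if f: "\<And>j. 0 \<le> f j" "\<And>j. f j \<le> 1" and g: "\<And>j. 0 \<le> g j" "\<And>j. g j \<le> 1"
      and le: "\<And>j. f j \<le> g j" and i: "0 < w i" "f i < g i" for f g :: "nat \<Rightarrow> real" and i
  proof -
    have "0 < (\<Sum>j. w j * g j - w j * f j)"
    proof (rule suminf_pos2)
      show "summable (\<lambda>j. w j * g j - w j * f j)"
        by (intro summable_diff summ f g)
      show "0 \<le> w j * g j - w j * f j" for j
        using mult_left_mono[OF le w(1), of j j] by simp
      show "0 < w i * g i - w i * f i" using i by simp
    qed
    also have "\<dots> = (\<Sum>j. w j * g j) - (\<Sum>j. w j * f j)"
      by (intro suminf_diff[symmetric] summ f g)
    finally show ?thesis by simp
  qed
  \<comment> \<open>The term at index 0 is \<open>w 0 * r 0 > 0\<close>. Strict positivity is used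
    below when \<open>r2_gt\<close> is multiplied by \<open>r 1 ^ l\<close>.\<close>
  have r1_pos: "0 < r 1"
    unfolding r1 using r w by (intro suminf_pos2[where i = 0] summ) auto
  \<comment> \<open>The left side is \<open>r 1 * r 1\<close>. For \<open>j \<ge> 1\<close> the
    termwise bound is \<open>mult\<close>; at \<open>j = 0\<close> truncation gives
    \<open>r 0 * r 1 = r 1 < 1 = r 0\<close>, and \<open>0 < w 0\<close> makes the sum strictly
    smaller.\<close>
  have "(\<Sum>j. w j * (r (j - 1) * r 1)) < (\<Sum>j. w j * r j)"
  proof (rule strict[where i = 0])
    show "r (j - 1) * r 1 \<le> r j" for j
      using mult[of "j - 1" 1] r less by (cases j) auto
    then show "r (j - 1) * r 1 \<le> 1" for j
      using r(2) order_trans by blast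
  qed (use r w less in auto)
  moreover have "(\<Sum>j. w j * (r (j - 1) * r 1)) = r 1 * r 1"
    using suminf_mult2[OF summ, of "\<lambda>j. r (j - 1)" "r 1"] r
    by (simp only: mult.assoc r1[symmetric])
  ultimately have r2_gt: "r 1 ^ 2 < r 2"
    by (simp add: r2 power2_eq_square)
  have power_le: "r 1 ^ k \<le> r k" for k
  proof (induction k)
    case (Suc k)
    have "r 1 ^ Suc k \<le> r 1 * r k"
      using Suc.IH r1_pos by (simp add: mult_left_mono)
    also have "\<dots> \<le> r (Suc k)" using mult[of 1 k] by simp
    finally show ?case .
  qed (simp add: r)
  have power_less: "r 1 ^ k < r k" if "2 \<le> k" for k
  proof -
    from that obtain l where k: "k = 2 + l" by (auto simp: le_iff_add)
    have "r 1 ^ k = r 1 ^ 2 * r 1 ^ l" unfolding k by (rule power_add)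
    also have "\<dots> < r 2 * r 1 ^ l" using r2_gt r1_pos by simp
    also have "\<dots> \<le> r 2 * r l" using power_le r by (intro mult_left_mono) auto
    also have "\<dots> \<le> r k" unfolding k by (rule mult)
    finally show ?thesis .
  qed
  \<comment> \<open>If only 0 and 1 carried weight, every \<open>r (j - 1)\<close> that counts in
    \<open>r1\<close> would be \<open>r 0 = 1\<close>, and \<open>r 1\<close> would be the total
    mass 1.\<close>
  have "\<exists>k\<ge>2. 0 < w k"
  proof (rule ccontr)
    assume "\<not> (\<exists>k\<ge>2. 0 < w k)"
    then have zero: "w k = 0" if "2 \<le> k" for k
      using that w(1)[of k] by force
    have "w j * r (j - 1) = w j" for j
      using zero[of j] r(3) by (cases "2 \<le> j") (auto simp: not_le less_2_cases_iff)
    then have "r 1 = 1" unfolding r1 by (simp only: sums_unique[OF w(2), symmetric])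
    with less show False by simp
  qed
  then obtain k where "2 \<le> k" "0 < w k" by blast
  then show ?thesis
    using r r1_pos less power_le power_less by (intro strict[where i = k]) (auto simp: power_le_one)
qed

section \<open>Galton-Watson trees\<close>

locale galton_watson_tree = prob_space M
  for M :: "'a measure" and \<xi> :: "'a \<Rightarrow> nat" and T :: "'a \<Rightarrow> family_tree" +
  assumes measurable_xi: "\<xi> \<in> measurable M (count_space UNIV)"
    and galton_watson: "galton_watson M \<xi> T"
begin

definition weight :: "nat \<Rightarrow> real" where
  "weight j = prob {\<omega> \<in> space M. \<xi> \<omega> = j}"

definition agree :: "family_tree \<Rightarrow> node set \<Rightarrow> 'a set" where
  "agree \<tau> A = {\<omega> \<in> space M. \<forall>u\<in>A. T \<omega> u = \<tau> u}"

lemma indep_offspring: "indep_vars (\<lambda>_. count_space UNIV) (\<lambda>v \<omega>. T \<omega> v) UNIV"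
  using galton_watson by (simp add: galton_watson_def)

lemma measurable_offspring [measurable]: "(\<lambda>\<omega>. T \<omega> v) \<in> measurable M (count_space UNIV)"
  using indep_offspring by (simp add: indep_vars_def)

lemma prob_offspring: "prob {\<omega> \<in> space M. T \<omega> v = j} = weight j"
proof -
  have "prob {\<omega> \<in> space M. f \<omega> = j} = measure (distr M (count_space UNIV) f) {j}"
    if "f \<in> measurable M (count_space UNIV)" for f :: "'a \<Rightarrow> nat"
    using that by (subst measure_distr) (auto intro!: arg_cong[where f = prob])
  from this[OF measurable_offspring[of v]] this[OF measurable_xi] show ?thesis
    using galton_watson by (simp add: galton_watson_def weight_def)
qed

lemma weight_nonneg [simp]: "0 \<le> weight j"
  by (simp add: weight_def)

lemma weight_sums_1: "weight sums 1"
proof -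
  have "(\<lambda>j. prob (\<xi> -` {j} \<inter> space M)) sums prob (\<Union>j. \<xi> -` {j} \<inter> space M)"
    using measurable_xi by (intro finite_measure_UNION) (auto simp: disjoint_family_on_def)
  moreover have "(\<Union>j. \<xi> -` {j} \<inter> space M) = space M" by auto
  moreover have "prob (\<xi> -` {j} \<inter> space M) = weight j" for j
    unfolding weight_def by (auto intro!: arg_cong[where f = prob])
  ultimately show ?thesis by (simp add: prob_space)
qed

lemma suminf_weight: "(\<Sum>j. ennreal (weight j)) = 1"
  using suminf_ennreal2[OF weight_nonneg sums_summable[OF weight_sums_1]]
    sums_unique[OF weight_sums_1] by simp

lemma sets_agree: "finite A \<Longrightarrow> agree \<tau> A \<in> sets M"
  unfolding agree_def by measurable

lemma prob_agree:
  assumes "finite A" and "A \<noteq> {}"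
  shows "prob (agree \<tau> A) = (\<Prod>u\<in>A. weight (\<tau> u))"
proof -
  \<comment> \<open>For empty \<open>A\<close> the intersection would be the whole type instead of
    \<open>space M\<close>. Below, \<open>A\<close> always contains the root.\<close>
  have "agree \<tau> A = (\<Inter>u\<in>A. (\<lambda>\<omega>. T \<omega> u) -` {\<tau> u} \<inter> space M)"
    using assms(2) by (auto simp: agree_def)
  also have "prob \<dots> = (\<Prod>u\<in>A. prob ((\<lambda>\<omega>. T \<omega> u) -` {\<tau> u} \<inter> space M))"
    by (rule indep_varsD[OF indep_offspring]) (use assms in auto)
  also have "\<dots> = (\<Prod>u\<in>A. weight (\<tau> u))"
    by (intro prod.cong refl, subst prob_offspring[symmetric])
      (auto intro!: arg_cong[where f = prob])
  finally show ?thesis .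
qed

text \<open>Conditioning in product form: the number at a fresh node is independent of those already
  revealed.\<close>

lemma emeasure_agree_insert:
  assumes "finite A" and "A \<noteq> {}" and "v \<notin> A"
  shows "emeasure M (agree (\<tau>(v := j)) (insert v A)) = emeasure M (agree \<tau> A) * ennreal (weight j)"
proof -
  have "(\<Prod>u\<in>A. weight ((\<tau>(v := j)) u)) = (\<Prod>u\<in>A. weight (\<tau> u))"
    using assms(3) by (intro prod.cong) auto
  then have "prob (agree (\<tau>(v := j)) (insert v A)) = prob (agree \<tau> A) * weight j"
    using assms by (simp add: prob_agree)
  then show ?thesis
    by (simp add: emeasure_eq_measure ennreal_mult)
qed

text \<open>
  The tree \<open>\<tau>\<close> only carries the offspring numbers revealed by the history \<open>h\<close>; its values
  outside \<open>internal h\<close> are arbitrary.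
\<close>

lemma emeasure_agree_exhausted:
  assumes adm: "admissible \<sigma>" and "valid_history \<tau> h"
  shows "{\<omega> \<in> agree \<tau> (internal h). exhausted \<sigma> (T \<omega>) n c h} \<in> sets M"
    and "emeasure M {\<omega> \<in> agree \<tau> (internal h). exhausted \<sigma> (T \<omega>) n c h} =
      emeasure M (agree \<tau> (internal h)) * exhaust_prob weight n c (card (external \<tau> h))"
proof -
  let ?E = "\<lambda>\<tau> n c h. {\<omega> \<in> agree \<tau> (internal h). exhausted \<sigma> (T \<omega>) n c h}"
  let ?P = "\<lambda>\<tau> n c h. ?E \<tau> n c h \<in> sets M \<and> emeasure M (?E \<tau> n c h) =
    emeasure M (agree \<tau> (internal h)) * exhaust_prob weight n c (card (external \<tau> h))"
  have ext: "external (T \<omega>) h = external \<tau> h" and vis: "visible (T \<omega>) h = visible \<tau> h"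
    if "\<omega> \<in> agree \<tau> (internal h)" for \<omega> \<tau> h
    using that by (auto simp: agree_def intro!: external_cong visible_cong)
  have "?P \<tau> n c h"
    using assms(2)
  proof (induction n arbitrary: c h \<tau>)
    case 0
    have "?E \<tau> 0 c h = (if external \<tau> h = {} then agree \<tau> (internal h) else {})"
      by (auto simp: ext)
    then show ?case by (simp add: sets_agree)
  next
    case (Suc n)
    show ?case
    proof (cases "external \<tau> h = {}")
      case True
      then have "?E \<tau> (Suc n) c h = agree \<tau> (internal h)"
        by (auto simp: ext)
      then show ?thesis using True by (simp add: sets_agree)
    next
      case False
      \<comment> \<open>The rule sees only revealed numbers, so the same edge \<open>v\<close> is
        chosen on the whole event \<open>agree \<tau> (internal h)\<close>.\<close>
      define v where "v = \<sigma> c h (visible \<tau> h)"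
      have v: "v \<in> external \<tau> h"
        unfolding v_def by (rule admissibleD[OF adm False])
      then have v_new: "v \<notin> internal h" by (simp add: external_def)
      have exhausted_iff:
        "exhausted \<sigma> (T \<omega>) (Suc n) c h \<longleftrightarrow> exhausted \<sigma> (T \<omega>) n (opponent c) ((c, v) # h)"
        if "\<omega> \<in> agree \<tau> (internal h)" for \<omega>
        using False by (simp add: ext[OF that] vis[OF that] v_def)
      have card_pos: "card (external \<tau> h) \<noteq> 0" using False by simp
      show ?thesis
      proof (cases c)
        case Breaker
        have "?E \<tau> (Suc n) c h = ?E \<tau> n Maker ((Breaker, v) # h)"
          using exhausted_iff Breaker by auto
        moreover have "?P \<tau> n Maker ((Breaker, v) # h)"
          by (rule Suc.IH) (rule valid_history_Cons[OF Suc.prems v])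
        ultimately show ?thesis
          using card_pos
          by (simp add: Breaker card_external_Breaker[OF v] del: exhausted.simps)
      next
        case Maker
        \<comment> \<open>Maker's move reveals the number at \<open>v\<close>. The event is split
          over its values \<open>j\<close>, recorded by overwriting \<open>\<tau>\<close> at
          \<open>v\<close>; as \<open>v\<close> is not internal, the position \<open>h\<close> is
          unaffected.\<close>
        let ?\<tau> = "\<lambda>j. \<tau>(v := j)"
        let ?h = "(Maker, v) # h"
        have same: "external (?\<tau> j) h = external \<tau> h" for j
          using v_new by (intro external_cong) auto
        have val: "valid_history (?\<tau> j) h" for j
          using Suc.prems v_new valid_history_cong[of h "?\<tau> j" \<tau>] by fastforce
        have IH: "?P (?\<tau> j) n Breaker ?h" for j
          by (rule Suc.IH, rule valid_history_Cons[OF val]) (simp only: same v)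
        have card: "card (external (?\<tau> j) ?h) = card (external \<tau> h) - 1 + j" for j
          using card_external_Maker[OF val] v same by simp
        have split: "?E \<tau> (Suc n) c h = (\<Union>j. ?E (?\<tau> j) n Breaker ?h)"
        proof (intro set_eqI)
          fix \<omega>
          have "\<omega> \<in> agree \<tau> (internal h) \<longleftrightarrow> (\<exists>j. \<omega> \<in> agree (?\<tau> j) (internal ?h))"
            using v_new by (auto simp: agree_def)
          then show "\<omega> \<in> ?E \<tau> (Suc n) c h \<longleftrightarrow> \<omega> \<in> (\<Union>j. ?E (?\<tau> j) n Breaker ?h)"
            using exhausted_iff[of \<omega>] Maker by auto
        qed
        have "disjoint_family (\<lambda>j. ?E (?\<tau> j) n Breaker ?h)"
          by (auto simp: disjoint_family_on_def agree_def)
        then have "emeasure M (?E \<tau> (Suc n) c h) = (\<Sum>j. emeasure M (?E (?\<tau> j) n Breaker ?h))"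
          unfolding split using IH by (intro suminf_emeasure[symmetric]) auto
        also have "\<dots> = (\<Sum>j. emeasure M (agree \<tau> (internal h)) *
            (weight j * exhaust_prob weight n Breaker (card (external \<tau> h) - 1 + j)))"
        proof (intro suminf_cong)
          fix j
          have "emeasure M (agree (?\<tau> j) (internal ?h)) =
              emeasure M (agree \<tau> (internal h)) * ennreal (weight j)"
            using emeasure_agree_insert[of "internal h" v \<tau> j] v_new Nil_in_internal[of h]
            by (auto simp del: Nil_in_internal)
          then show "emeasure M (?E (?\<tau> j) n Breaker ?h) = emeasure M (agree \<tau> (internal h)) *
              (weight j * exhaust_prob weight n Breaker (card (external \<tau> h) - 1 + j))"
            using IH[of j] card[of j] by (simp add: mult.assoc)
        qed
        finally have "emeasure M (?E \<tau> (Suc n) c h) =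
            emeasure M (agree \<tau> (internal h)) * exhaust_prob weight (Suc n) c (card (external \<tau> h))"
          using card_pos
          by (simp only: Maker exhaust_prob.simps if_False player.simps ennreal_suminf_cmult)
        moreover have "?E \<tau> (Suc n) c h \<in> sets M"
          unfolding split using IH by auto
        ultimately show ?thesis by blast
      qed
    qed
  qed
  then show "?E \<tau> n c h \<in> sets M" and "emeasure M (?E \<tau> n c h) =
    emeasure M (agree \<tau> (internal h)) * exhaust_prob weight n c (card (external \<tau> h))"
    by blast+
qed

text \<open>The root is internal from the outset: its number \<open>j\<close> is known, and
  \<open>j\<close> edges are available at the first turn. The constant tree
  \<open>\<lambda>_. j\<close> records it, since only the value at the root matters.\<close>

lemma emeasure_exhausted_Nil:
  assumes "admissible \<sigma>"
  shows "{\<omega> \<in> space M. exhausted \<sigma> (T \<omega>) n a []} \<in> sets M"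
    and "emeasure M {\<omega> \<in> space M. exhausted \<sigma> (T \<omega>) n a []} =
      (\<Sum>j. weight j * exhaust_prob weight n a j)"
proof -
  let ?E = "\<lambda>j. {\<omega> \<in> agree (\<lambda>_. j) (internal []). exhausted \<sigma> (T \<omega>) n a []}"
  have split: "{\<omega> \<in> space M. exhausted \<sigma> (T \<omega>) n a []} = (\<Union>j. ?E j)"
    by (auto simp: agree_def)
  have sets: "?E j \<in> sets M" for j
    by (rule emeasure_agree_exhausted[OF assms valid_history_Nil])
  show "{\<omega> \<in> space M. exhausted \<sigma> (T \<omega>) n a []} \<in> sets M"
    unfolding split using sets by blast
  have "emeasure M (?E j) = weight j * exhaust_prob weight n a j" for j
  proof -
    have "external (\<lambda>_. j) [] = (\<lambda>i. [i]) ` {..<j}"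
      by (auto simp: external_def)
    then have "card (external (\<lambda>_. j) []) = j"
      by (simp add: card_image inj_on_def)
    moreover have "emeasure M (agree (\<lambda>_. j) (internal [])) = weight j"
      by (simp add: emeasure_eq_measure prob_agree)
    ultimately show ?thesis
      by (simp only: emeasure_agree_exhausted(2)[OF assms valid_history_Nil])
  qed
  moreover have "disjoint_family ?E"
    by (auto simp: disjoint_family_on_def agree_def)
  ultimately show "emeasure M {\<omega> \<in> space M. exhausted \<sigma> (T \<omega>) n a []} =
      (\<Sum>j. weight j * exhaust_prob weight n a j)"
    unfolding split using sets by (subst suminf_emeasure[symmetric]) auto
qed

text \<open>Continuity from below in the number of turns. The right side does not mention
  \<open>\<sigma>\<close>, so the choice of edges does not affect the probability.\<close>

lemma breaker_win_prob_eq: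
  assumes "admissible \<sigma>"
  shows "ennreal (breaker_win_prob M T a \<sigma>) = (\<Sum>j. weight j * ruin_prob weight a j)"
proof -
  let ?W = "\<lambda>n. {\<omega> \<in> space M. exhausted \<sigma> (T \<omega>) n a []}"
  have "{\<omega> \<in> space M. breaker_wins a \<sigma> (T \<omega>)} = (\<Union>n. ?W n)"
    by (auto simp: breaker_wins_iff_exhausted[OF assms])
  then have "ennreal (breaker_win_prob M T a \<sigma>) = emeasure M (\<Union>n. ?W n)"
    by (simp add: breaker_win_prob_def emeasure_eq_measure)
  also have "\<dots> = (SUP n. emeasure M (?W n))"
    using emeasure_exhausted_Nil(1)[OF assms]
    by (intro SUP_emeasure_incseq[symmetric] incseq_SucI)
      (auto simp del: exhausted.simps intro: exhausted_Suc)
  also have "\<dots> = (\<Sum>j. weight j * ruin_prob weight a j)"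
    by (simp add: emeasure_exhausted_Nil(2)[OF assms] suminf_mult_ruin_prob)
  finally show ?thesis .
qed

section \<open>Real-valued ruin probabilities and the two winning probabilities\<close>

definition ruin :: "nat \<Rightarrow> real" where
  "ruin k = enn2real (ruin_prob weight Maker k)"

lemma ennreal_ruin: "ennreal (ruin k) = ruin_prob weight Maker k"
  unfolding ruin_def
  using ruin_prob_le_1[of weight Maker k] suminf_weight
  by (intro ennreal_enn2real) (auto simp: less_top[symmetric] top_unique)

lemma ruin_nonneg [simp]: "0 \<le> ruin k"
  by (simp add: ruin_def)

lemma ruin_0: "ruin 0 = 1"
  by (simp add: ruin_def)

lemma ruin_le_1: "ruin k \<le> 1"
  using ruin_prob_le_1[of weight Maker k] suminf_weight
  by (simp add: ennreal_ruin[symmetric])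

lemma ruin_mult_le: "ruin k * ruin l \<le> ruin (k + l)"
  using ruin_prob_mult_le[of weight k l] suminf_weight
  by (simp add: ennreal_ruin[symmetric] ennreal_mult[symmetric])

text \<open>Transfers series identities from \<open>ennreal\<close> to the reals;
  \<open>ruin_le_1\<close> gives summability by comparison with the weights.\<close>

lemma ennreal_eq_suminf_ruin:
  assumes "ennreal x = (\<Sum>j. weight j * ruin_prob weight Maker (f j))" and "0 \<le> x"
  shows "x = (\<Sum>j. weight j * ruin (f j))"
proof -
  have "summable (\<lambda>j. weight j * ruin (f j))"
  proof (rule summable_comparison_test'[OF sums_summable[OF weight_sums_1]])
    fix j show "norm (weight j * ruin (f j)) \<le> weight j"
      using mult_left_mono[OF ruin_le_1, of "weight j"] by (simp add: abs_mult)
  qed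
  then have "ennreal (\<Sum>j. weight j * ruin (f j)) = (\<Sum>j. ennreal (weight j * ruin (f j)))"
    by (intro suminf_ennreal2[symmetric]) auto
  also have "\<dots> = ennreal x"
    by (simp add: assms(1) ennreal_mult ennreal_ruin)
  finally show ?thesis
    using assms(2) \<open>summable _\<close> by (subst (asm) ennreal_inj) (auto intro: suminf_nonneg)
qed

lemma ruin_prob_Breaker: "ruin_prob weight Breaker j = ruin_prob weight Maker (j - 1)"
  by (cases j) (auto simp: ruin_prob_Breaker_Suc)

text \<open>Maker's move leaves \<open>k + j\<close> edges and Breaker's reply removes one more. For
  \<open>k = j = 0\<close> the edges are already gone, and truncation correctly yields
  \<open>ruin 0 = 1\<close>.\<close>

lemma ruin_Suc: "ruin (Suc k) = (\<Sum>j. weight j * ruin (k + j - 1))"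
  by (rule ennreal_eq_suminf_ruin)
    (simp_all add: ennreal_ruin ruin_prob_Maker_Suc ruin_prob_Breaker)

text \<open>Revealing the root acts like Maker's move from a single available edge, so the series
  over the root's number is the first-step equation of \<open>ruin 1\<close>.\<close>

lemma breaker_win_prob_Breaker:
  assumes "admissible \<sigma>"
  shows "breaker_win_prob M T Breaker \<sigma> = ruin 1"
proof -
  have "breaker_win_prob M T Breaker \<sigma> = (\<Sum>j. weight j * ruin (j - 1))"
    by (rule ennreal_eq_suminf_ruin)
      (simp_all add: breaker_win_prob_eq[OF assms] ruin_prob_Breaker,
        simp add: breaker_win_prob_def)
  then show ?thesis using ruin_Suc[of 0] by simp
qed

lemma breaker_win_prob_Maker:
  assumes "admissible \<sigma>"
  shows "breaker_win_prob M T Maker \<sigma> = (\<Sum>j. weight j * ruin j)"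
  by (rule ennreal_eq_suminf_ruin)
    (simp_all add: breaker_win_prob_eq[OF assms], simp add: breaker_win_prob_def)

end

theorem proposition5p4:
  fixes M :: "'a measure" and \<xi> :: "'a \<Rightarrow> nat" and T :: "'a \<Rightarrow> family_tree"
    and \<sigma> \<sigma>' :: choice_rule and p pbar :: real
  assumes "prob_space M"
    and "\<xi> \<in> measurable M (count_space UNIV)"
    and "measure M {\<omega> \<in> space M. \<xi> \<omega> = 0} > 0"
    and "galton_watson M \<xi> T"
    and "admissible \<sigma>" and "admissible \<sigma>'"
    and "p = breaker_win_prob M T Breaker \<sigma>"
    and "pbar = breaker_win_prob M T Maker \<sigma>'"
    and "p < 1"
  shows "pbar > pgf M \<xi> p"
proof -
  interpret galton_watson_tree M \<xi> T
    using assms(1,2,4) by (simp add: galton_watson_tree_def galton_watson_tree_axioms_def)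
  have p: "p = ruin 1"
    using assms(5,7) by (simp add: breaker_win_prob_Breaker)
  have "(\<Sum>j. weight j * ruin 1 ^ j) < (\<Sum>j. weight j * ruin j)"
  proof (rule suminf_power_less_suminf)
    \<comment> \<open>These are the cases \<open>k = 0\<close> and \<open>k = 1\<close> of
      \<open>ruin_Suc\<close>; in the second, \<open>1 + j - 1 = j\<close> without
      truncation.\<close>
    show "ruin 1 = (\<Sum>j. weight j * ruin (j - 1))" using ruin_Suc[of 0] by simp
    show "ruin 2 = (\<Sum>j. weight j * ruin j)" using ruin_Suc[of 1] by (simp add: numeral_2_eq_2)
    show "0 < weight 0" using assms(3) by (simp add: weight_def)
    show "ruin 1 < 1" using assms(9) p by simp
  qed (simp_all add: weight_sums_1 ruin_0 ruin_le_1 ruin_mult_le)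
  then show ?thesis
    using assms(6,8) p by (simp add: breaker_win_prob_Maker pgf_def weight_def)
qed

end
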